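(* Let $\mathcal{Q}$ be the ordered vector space of all quasimartingales on a filtered probability space $(\Omega,\mathcal{F},(\mathcal{F}_t)_{t\ge 0},P)$ satisfying the usual conditions. Then $\mathcal{Q}$ satisfies the interpolation property: for every pair of nonempty finite subsets $E,F\subset\mathcal{Q}$ with $X\le Y$ for all $X\in E$ and $Y\in F$, there exists $Z\in\mathcal{Q}$ such that $X\le Z\le Y$ for all $X\in E$ and $Y\in F$. In particular, for any two quasimartingales $X$ and $Y$ with $X\le Y$ there is a quasimartingale $Z$ such that $X\le Z\le Y$.
   Context: All processes are real-valued, indexed by $t\in[0,\infty)$, defined on the fixed filtered probability space (with filtration satisfying the usual conditions), and c\`adl\`ag (right-continuous with left-hand limits). For processes $X,Y$, write $X\le Y$ if for every $t\ge 0$ one has $X_t\le Y_t$ almost surely; processes $X,Y$ with $X_t=Y_t$ almost surely for every $t$ are identified. The variation of a process $X$ is $$\mathrm{Var}(X)=\sup_{\pi}\left[\sum_{i=0}^{n-1}E\big[\,|X_{t_i}-E[X_{t_{i+1}}\mid\mathcal{F}_{t_i}]|\,\big]+E|X_{t_n}|\right],$$ where the supremum is over all finite partitions $\pi: 0=t_0<t_1<\dots<t_n<\infty$. A quasimartingale is an adapted process $X$ such that $X_t$ is integrable for all $t\ge0$ and $\mathrm{Var}(X)<\infty$. *)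

theory Defs
  imports "HOL-Probability.Probability"
begin

text \<open>
  The time set \<open>[0,\<infinity>)\<close> is the set of nonnegative reals inside \<^typ>\<open>real\<close>.  Processes and
  filtrations are functions on \<^typ>\<open>real\<close>, and every condition below constrains them only at
  times \<open>t \<ge> 0\<close>; their values at negative times are irrelevant.
\<close>

locale usual_filtered_prob_space = prob_space M + complete_measure M
  for M :: "'a measure" +
  fixes F :: "real \<Rightarrow> 'a measure"
  assumes subalg: "0 \<le> t \<Longrightarrow> subalgebra M (F t)"
    and filtration_mono: "0 \<le> s \<Longrightarrow> s \<le> t \<Longrightarrow> sets (F s) \<subseteq> sets (F t)"
    and null_sets_subset: "null_sets M \<subseteq> sets (F 0)"
    and right_cont: "0 \<le> t \<Longrightarrow> sets (F t) = (\<Inter>s\<in>{t<..}. sets (F s))"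

definition adapted :: "(real \<Rightarrow> 'a measure) \<Rightarrow> (real \<Rightarrow> 'a \<Rightarrow> real) \<Rightarrow> bool" where
  "adapted F X \<longleftrightarrow> (\<forall>t\<ge>0. X t \<in> borel_measurable (F t))"

definition cadlag :: "'a measure \<Rightarrow> (real \<Rightarrow> 'a \<Rightarrow> real) \<Rightarrow> bool" where
  "cadlag M X \<longleftrightarrow> (\<forall>\<omega>\<in>space M.
     (\<forall>t\<ge>0. ((\<lambda>s. X s \<omega>) \<longlongrightarrow> X t \<omega>) (at_right t)) \<and>
     (\<forall>t>0. \<exists>l. ((\<lambda>s. X s \<omega>) \<longlongrightarrow> l) (at_left t)))"

text \<open>A pair \<open>(n, \<tau>)\<close> encodes the partition \<open>0 = \<tau> 0 < \<tau> 1 < \<dots> < \<tau> n\<close>.\<close>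

definition time_partitions :: "(nat \<times> (nat \<Rightarrow> real)) set" where
  "time_partitions = {(n, \<tau>). \<tau> 0 = 0 \<and> (\<forall>i<n. \<tau> i < \<tau> (Suc i))}"

definition variation :: "'a measure \<Rightarrow> (real \<Rightarrow> 'a measure) \<Rightarrow> (real \<Rightarrow> 'a \<Rightarrow> real) \<Rightarrow> ennreal" where
  "variation M F X = (SUP (n, \<tau>)\<in>time_partitions.
     (\<Sum>i<n. \<integral>\<^sup>+\<omega>. ennreal \<bar>X (\<tau> i) \<omega> - real_cond_exp M (F (\<tau> i)) (X (\<tau> (Suc i))) \<omega>\<bar> \<partial>M)
     + (\<integral>\<^sup>+\<omega>. ennreal \<bar>X (\<tau> n) \<omega>\<bar> \<partial>M))"

definition quasimartingales :: "'a measure \<Rightarrow> (real \<Rightarrow> 'a measure) \<Rightarrow> (real \<Rightarrow> 'a \<Rightarrow> real) set" where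
  "quasimartingales M F = {X. adapted F X \<and> cadlag M X \<and>
     (\<forall>t\<ge>0. integrable M (X t)) \<and> variation M F X < \<infinity>}"

definition process_le :: "'a measure \<Rightarrow> (real \<Rightarrow> 'a \<Rightarrow> real) \<Rightarrow> (real \<Rightarrow> 'a \<Rightarrow> real) \<Rightarrow> bool" where
  "process_le M X Y \<longleftrightarrow> (\<forall>t\<ge>0. AE \<omega> in M. X t \<omega> \<le> Y t \<omega>)"

text \<open>
  Elements of the space of quasimartingales are handled through representatives; two processes are
  identified if they agree almost surely at every time.  The following lemmas say that
  \<^const>\<open>process_le\<close> is a vector-space preorder whose associated equivalence is this identification,
  and that \<^const>\<open>quasimartingales\<close> is a linear space, so modulo the identification it is an ordered
  vector space.
\<close>

lemma process_le_refl: "process_le M X X"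
  by (simp add: process_le_def)

lemma process_le_trans: "process_le M X Y \<Longrightarrow> process_le M Y Z \<Longrightarrow> process_le M X Z"
  unfolding process_le_def
proof (intro allI impI)
  fix t :: real
  assume "\<forall>t\<ge>0. AE \<omega> in M. X t \<omega> \<le> Y t \<omega>" "\<forall>t\<ge>0. AE \<omega> in M. Y t \<omega> \<le> Z t \<omega>" "0 \<le> t"
  then have "AE \<omega> in M. X t \<omega> \<le> Y t \<omega>" "AE \<omega> in M. Y t \<omega> \<le> Z t \<omega>"
    by auto
  then show "AE \<omega> in M. X t \<omega> \<le> Z t \<omega>"
    by eventually_elim (rule order_trans)
qed

lemma process_le_antisym_iff:
  "process_le M X Y \<and> process_le M Y X \<longleftrightarrow> (\<forall>t\<ge>0. AE \<omega> in M. X t \<omega> = Y t \<omega>)"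
proof -
  have "(AE \<omega> in M. X t \<omega> = Y t \<omega>) \<longleftrightarrow> (AE \<omega> in M. X t \<omega> \<le> Y t \<omega>) \<and> (AE \<omega> in M. Y t \<omega> \<le> X t \<omega>)" for t
    by (subst AE_conj_iff[symmetric]) (simp only: order_eq_iff[where 'a=real])
  then show ?thesis
    by (auto simp: process_le_def)
qed

lemma process_le_add:
  assumes "process_le M X Y"
  shows "process_le M (\<lambda>t \<omega>. X t \<omega> + Z t \<omega>) (\<lambda>t \<omega>. Y t \<omega> + Z t \<omega>)"
  using assms by (simp add: process_le_def)

lemma process_le_scale:
  assumes "process_le M X Y" "0 \<le> c"
  shows "process_le M (\<lambda>t \<omega>. c * X t \<omega>) (\<lambda>t \<omega>. c * Y t \<omega>)"
proof -
  have "AE \<omega> in M. c * X t \<omega> \<le> c * Y t \<omega>" if "0 \<le> t" for t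
  proof -
    have "AE \<omega> in M. X t \<omega> \<le> Y t \<omega>"
      using assms(1) that by (simp add: process_le_def)
    then show ?thesis
      by eventually_elim (use assms(2) in \<open>auto intro: mult_left_mono\<close>)
  qed
  then show ?thesis by (simp add: process_le_def)
qed

lemma time_partitions_nonneg:
  assumes "(n, \<tau>) \<in> time_partitions" "i \<le> n"
  shows "0 \<le> \<tau> i"
  using assms(2)
proof (induction i)
  case 0
  then show ?case using assms(1) by (simp add: time_partitions_def)
next
  case (Suc i)
  then have "\<tau> i < \<tau> (Suc i)" using assms(1) by (simp add: time_partitions_def)
  with Suc show ?case by simp
qed

context usual_filtered_prob_space
begin

lemma finite_measure_subalgebra_F: "0 \<le> t \<Longrightarrow> finite_measure_subalgebra M (F t)"
  by unfold_locales (rule subalg)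

lemma adapted_borel_measurable:
  "adapted F X \<Longrightarrow> 0 \<le> t \<Longrightarrow> X t \<in> borel_measurable M"
  using measurable_from_subalg[OF subalg] by (auto simp: adapted_def)

lemma quasimartingales_zero: "(\<lambda>t \<omega>. 0) \<in> quasimartingales M F"
proof -
  have "(\<integral>\<^sup>+\<omega>. ennreal \<bar>0 - real_cond_exp M (F t) (\<lambda>\<omega>. 0) \<omega>\<bar> \<partial>M) = 0" if "0 \<le> t" for t
  proof -
    interpret S: finite_measure_subalgebra M "F t" by (rule finite_measure_subalgebra_F[OF that])
    have "AE \<omega> in M. real_cond_exp M (F t) (\<lambda>\<omega>. 0) \<omega> = 0"
      by (rule S.real_cond_exp_F_meas) auto
    then show ?thesis by (subst nn_integral_0_iff_AE) auto
  qed
  then have "variation M F (\<lambda>t \<omega>. 0) \<le> 0"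
    unfolding variation_def
    by (intro SUP_least) (auto simp: time_partitions_nonneg)
  then show ?thesis
    by (auto simp: quasimartingales_def adapted_def cadlag_def)
qed

lemma quasimartingales_scale:
  assumes "X \<in> quasimartingales M F"
  shows "(\<lambda>t \<omega>. c * X t \<omega>) \<in> quasimartingales M F"
proof -
  from assms have X: "adapted F X" "cadlag M X" "\<And>t. 0 \<le> t \<Longrightarrow> integrable M (X t)"
      "variation M F X < \<infinity>"
    by (auto simp: quasimartingales_def)
  have scale: "(\<integral>\<^sup>+\<omega>. ennreal \<bar>c * f \<omega>\<bar> \<partial>M) = ennreal \<bar>c\<bar> * (\<integral>\<^sup>+\<omega>. ennreal \<bar>f \<omega>\<bar> \<partial>M)"
    if [measurable]: "f \<in> borel_measurable M" for f
    by (subst nn_integral_cmult[symmetric]) (auto simp: abs_mult ennreal_mult)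
  have step: "(\<integral>\<^sup>+\<omega>. ennreal \<bar>c * X s \<omega> - real_cond_exp M (F s) (\<lambda>\<omega>. c * X t \<omega>) \<omega>\<bar> \<partial>M)
      = ennreal \<bar>c\<bar> * (\<integral>\<^sup>+\<omega>. ennreal \<bar>X s \<omega> - real_cond_exp M (F s) (X t) \<omega>\<bar> \<partial>M)"
    if st: "0 \<le> s" "0 \<le> t" for s t
  proof -
    interpret S: finite_measure_subalgebra M "F s" by (rule finite_measure_subalgebra_F[OF st(1)])
    have [measurable]: "X s \<in> borel_measurable M" by (rule adapted_borel_measurable[OF X(1) st(1)])
    have "AE \<omega> in M. real_cond_exp M (F s) (\<lambda>\<omega>. c * X t \<omega>) \<omega> = c * real_cond_exp M (F s) (X t) \<omega>"
      by (rule S.real_cond_exp_cmult[OF X(3)[OF st(2)]])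
    then have "(\<integral>\<^sup>+\<omega>. ennreal \<bar>c * X s \<omega> - real_cond_exp M (F s) (\<lambda>\<omega>. c * X t \<omega>) \<omega>\<bar> \<partial>M)
        = (\<integral>\<^sup>+\<omega>. ennreal \<bar>c * (X s \<omega> - real_cond_exp M (F s) (X t) \<omega>)\<bar> \<partial>M)"
      by (intro nn_integral_cong_AE) (auto simp: right_diff_distrib)
    also have "\<dots> = ennreal \<bar>c\<bar> * (\<integral>\<^sup>+\<omega>. ennreal \<bar>X s \<omega> - real_cond_exp M (F s) (X t) \<omega>\<bar> \<partial>M)"
      by (rule scale) simp
    finally show ?thesis .
  qed
  have "variation M F (\<lambda>t \<omega>. c * X t \<omega>) \<le> ennreal \<bar>c\<bar> * variation M F X"
  proof (unfold variation_def[of M F "\<lambda>t \<omega>. c * X t \<omega>"], rule SUP_least, clarify)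
    fix n \<tau> assume p: "(n, \<tau>) \<in> time_partitions"
    note nn = time_partitions_nonneg[OF p]
    have "(\<Sum>i<n. \<integral>\<^sup>+\<omega>. ennreal \<bar>c * X (\<tau> i) \<omega> - real_cond_exp M (F (\<tau> i)) (\<lambda>\<omega>. c * X (\<tau> (Suc i)) \<omega>) \<omega>\<bar> \<partial>M)
         + (\<integral>\<^sup>+\<omega>. ennreal \<bar>c * X (\<tau> n) \<omega>\<bar> \<partial>M)
      = ennreal \<bar>c\<bar> * ((\<Sum>i<n. \<integral>\<^sup>+\<omega>. ennreal \<bar>X (\<tau> i) \<omega> - real_cond_exp M (F (\<tau> i)) (X (\<tau> (Suc i))) \<omega>\<bar> \<partial>M)
         + (\<integral>\<^sup>+\<omega>. ennreal \<bar>X (\<tau> n) \<omega>\<bar> \<partial>M))"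
      using nn by (simp add: step scale adapted_borel_measurable[OF X(1)] distrib_left sum_distrib_left)
    also have "\<dots> \<le> ennreal \<bar>c\<bar> * variation M F X"
      unfolding variation_def by (intro mult_left_mono SUP_upper2[OF p]) auto
    finally show "(\<Sum>i<n. \<integral>\<^sup>+\<omega>. ennreal \<bar>c * X (\<tau> i) \<omega> - real_cond_exp M (F (\<tau> i)) (\<lambda>\<omega>. c * X (\<tau> (Suc i)) \<omega>) \<omega>\<bar> \<partial>M)
         + (\<integral>\<^sup>+\<omega>. ennreal \<bar>c * X (\<tau> n) \<omega>\<bar> \<partial>M) \<le> ennreal \<bar>c\<bar> * variation M F X" .
  qed
  also have "\<dots> < \<infinity>"
    using X(4) by (simp add: ennreal_mult_less_top)
  finally have "variation M F (\<lambda>t \<omega>. c * X t \<omega>) < \<infinity>" .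
  moreover have "cadlag M (\<lambda>t \<omega>. c * X t \<omega>)"
    unfolding cadlag_def
  proof (intro ballI conjI allI impI)
    fix \<omega> and t :: real assume "\<omega> \<in> space M" "0 \<le> t"
    then show "((\<lambda>s. c * X s \<omega>) \<longlongrightarrow> c * X t \<omega>) (at_right t)"
      using X(2) by (intro tendsto_mult_left) (simp add: cadlag_def)
  next
    fix \<omega> and t :: real assume "\<omega> \<in> space M" "0 < t"
    then obtain l where "((\<lambda>s. X s \<omega>) \<longlongrightarrow> l) (at_left t)"
      using X(2) unfolding cadlag_def by blast
    then show "\<exists>l. ((\<lambda>s. c * X s \<omega>) \<longlongrightarrow> l) (at_left t)"
      by - (rule exI, rule tendsto_mult_left)
  qed
  ultimately show ?thesis
    using X(1,3) by (auto simp: quasimartingales_def adapted_def)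
qed

lemma quasimartingales_add:
  assumes "X \<in> quasimartingales M F" "Y \<in> quasimartingales M F"
  shows "(\<lambda>t \<omega>. X t \<omega> + Y t \<omega>) \<in> quasimartingales M F"
proof -
  from assms have X: "adapted F X" "cadlag M X" "\<And>t. 0 \<le> t \<Longrightarrow> integrable M (X t)"
      "variation M F X < \<infinity>"
    and Y: "adapted F Y" "cadlag M Y" "\<And>t. 0 \<le> t \<Longrightarrow> integrable M (Y t)"
      "variation M F Y < \<infinity>"
    by (auto simp: quasimartingales_def)
  have tri: "(\<integral>\<^sup>+\<omega>. ennreal \<bar>f \<omega> + g \<omega>\<bar> \<partial>M) \<le> (\<integral>\<^sup>+\<omega>. ennreal \<bar>f \<omega>\<bar> \<partial>M) + (\<integral>\<^sup>+\<omega>. ennreal \<bar>g \<omega>\<bar> \<partial>M)"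
    if [measurable]: "f \<in> borel_measurable M" "g \<in> borel_measurable M" for f g
    by (subst nn_integral_add[symmetric])
      (auto simp: ennreal_plus[symmetric] simp del: ennreal_plus intro!: nn_integral_mono ennreal_leI)
  have step: "(\<integral>\<^sup>+\<omega>. ennreal \<bar>X s \<omega> + Y s \<omega> - real_cond_exp M (F s) (\<lambda>\<omega>. X t \<omega> + Y t \<omega>) \<omega>\<bar> \<partial>M)
      \<le> (\<integral>\<^sup>+\<omega>. ennreal \<bar>X s \<omega> - real_cond_exp M (F s) (X t) \<omega>\<bar> \<partial>M)
        + (\<integral>\<^sup>+\<omega>. ennreal \<bar>Y s \<omega> - real_cond_exp M (F s) (Y t) \<omega>\<bar> \<partial>M)"
    if st: "0 \<le> s" "0 \<le> t" for s t
  proof -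
    interpret S: finite_measure_subalgebra M "F s" by (rule finite_measure_subalgebra_F[OF st(1)])
    have [measurable]: "X s \<in> borel_measurable M" "Y s \<in> borel_measurable M"
      using adapted_borel_measurable st(1) X(1) Y(1) by auto
    have "AE \<omega> in M. real_cond_exp M (F s) (\<lambda>\<omega>. X t \<omega> + Y t \<omega>) \<omega>
        = real_cond_exp M (F s) (X t) \<omega> + real_cond_exp M (F s) (Y t) \<omega>"
      by (rule S.real_cond_exp_add[OF X(3)[OF st(2)] Y(3)[OF st(2)]])
    then have "(\<integral>\<^sup>+\<omega>. ennreal \<bar>X s \<omega> + Y s \<omega> - real_cond_exp M (F s) (\<lambda>\<omega>. X t \<omega> + Y t \<omega>) \<omega>\<bar> \<partial>M)
        = (\<integral>\<^sup>+\<omega>. ennreal \<bar>(X s \<omega> - real_cond_exp M (F s) (X t) \<omega>)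
            + (Y s \<omega> - real_cond_exp M (F s) (Y t) \<omega>)\<bar> \<partial>M)"
      by (intro nn_integral_cong_AE) (auto simp: algebra_simps)
    also have "\<dots> \<le> (\<integral>\<^sup>+\<omega>. ennreal \<bar>X s \<omega> - real_cond_exp M (F s) (X t) \<omega>\<bar> \<partial>M)
        + (\<integral>\<^sup>+\<omega>. ennreal \<bar>Y s \<omega> - real_cond_exp M (F s) (Y t) \<omega>\<bar> \<partial>M)"
      by (rule tri) simp_all
    finally show ?thesis .
  qed
  have "variation M F (\<lambda>t \<omega>. X t \<omega> + Y t \<omega>) \<le> variation M F X + variation M F Y"
  proof (unfold variation_def[of M F "\<lambda>t \<omega>. X t \<omega> + Y t \<omega>"], rule SUP_least, clarify)
    fix n \<tau> assume p: "(n, \<tau>) \<in> time_partitions"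
    note nn = time_partitions_nonneg[OF p]
    let ?V = "\<lambda>Z. (\<Sum>i<n. \<integral>\<^sup>+\<omega>. ennreal \<bar>Z (\<tau> i) \<omega> - real_cond_exp M (F (\<tau> i)) (Z (\<tau> (Suc i))) \<omega>\<bar> \<partial>M)
         + (\<integral>\<^sup>+\<omega>. ennreal \<bar>Z (\<tau> n) \<omega>\<bar> \<partial>M)"
    have "?V (\<lambda>t \<omega>. X t \<omega> + Y t \<omega>)
      \<le> (\<Sum>i<n. (\<integral>\<^sup>+\<omega>. ennreal \<bar>X (\<tau> i) \<omega> - real_cond_exp M (F (\<tau> i)) (X (\<tau> (Suc i))) \<omega>\<bar> \<partial>M)
            + (\<integral>\<^sup>+\<omega>. ennreal \<bar>Y (\<tau> i) \<omega> - real_cond_exp M (F (\<tau> i)) (Y (\<tau> (Suc i))) \<omega>\<bar> \<partial>M))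
         + ((\<integral>\<^sup>+\<omega>. ennreal \<bar>X (\<tau> n) \<omega>\<bar> \<partial>M) + (\<integral>\<^sup>+\<omega>. ennreal \<bar>Y (\<tau> n) \<omega>\<bar> \<partial>M))"
      using nn by (intro add_mono sum_mono step tri adapted_borel_measurable X(1) Y(1)) auto
    also have "\<dots> = ?V X + ?V Y"
      by (simp add: sum.distrib ac_simps)
    also have "\<dots> \<le> variation M F X + variation M F Y"
      unfolding variation_def by (intro add_mono SUP_upper2[OF p]) auto
    finally show "?V (\<lambda>t \<omega>. X t \<omega> + Y t \<omega>) \<le> variation M F X + variation M F Y" .
  qed
  also have "\<dots> < \<infinity>"
    using X(4) Y(4) by simp
  finally have "variation M F (\<lambda>t \<omega>. X t \<omega> + Y t \<omega>) < \<infinity>" .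
  moreover have "cadlag M (\<lambda>t \<omega>. X t \<omega> + Y t \<omega>)"
    unfolding cadlag_def
  proof (intro ballI conjI allI impI)
    fix \<omega> and t :: real assume "\<omega> \<in> space M" "0 \<le> t"
    then show "((\<lambda>s. X s \<omega> + Y s \<omega>) \<longlongrightarrow> X t \<omega> + Y t \<omega>) (at_right t)"
      using X(2) Y(2) by (intro tendsto_add) (simp_all add: cadlag_def)
  next
    fix \<omega> and t :: real assume \<omega>: "\<omega> \<in> space M" "0 < t"
    obtain k where "((\<lambda>s. X s \<omega>) \<longlongrightarrow> k) (at_left t)"
      using X(2) \<omega> unfolding cadlag_def by blast
    moreover obtain l where "((\<lambda>s. Y s \<omega>) \<longlongrightarrow> l) (at_left t)"
      using Y(2) \<omega> unfolding cadlag_def by blast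
    ultimately show "\<exists>l. ((\<lambda>s. X s \<omega> + Y s \<omega>) \<longlongrightarrow> l) (at_left t)"
      by - (rule exI, rule tendsto_add)
  qed
  ultimately show ?thesis
    using X(1,3) Y(1,3) by (auto simp: quasimartingales_def adapted_def intro!: borel_measurable_add)
qed

end

end

theory Submission
  imports Defs
begin

text \<open>
  Quasimartingales form a lattice, so the pointwise maximum of the lower set interpolates.
  By Jensen's inequality, \<open>E[\<bar>X\<^sub>t\<bar> | F\<^sub>s]\<close> is at least \<open>\<bar>X\<^sub>s\<bar>\<close> minus \<open>\<bar>X\<^sub>s - E[X\<^sub>t | F\<^sub>s]\<bar>\<close>,
  so the positive parts of the increments \<open>\<bar>X\<^sub>s\<bar> - E[\<bar>X\<^sub>t\<bar> | F\<^sub>s]\<close> are controlled by the variation of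
  \<open>X\<close>, while their expectations telescope.  Hence \<open>Var \<bar>X\<bar> \<le> 2 Var X\<close>, and
  \<open>max X Y = (X + Y + \<bar>X - Y\<bar>) / 2\<close>.
\<close>

context usual_filtered_prob_space
begin

text \<open>This is the bound for one partition step, obtained by integrating a pointwise
  inequality. The integral of \<open>\<bar>f\<bar>\<close> is added on the left instead of
  subtracted on the right because subtraction in \<open>ennreal\<close> truncates; in this form the
  steps telescope by addition alone.\<close>

lemma abs_cond_increment_le:
  assumes t: "0 \<le> s" and X: "integrable M f" "integrable M g" "f \<in> borel_measurable (F s)"
  shows "(\<integral>\<^sup>+\<omega>. ennreal \<bar>\<bar>f \<omega>\<bar> - real_cond_exp M (F s) (\<lambda>\<omega>. \<bar>g \<omega>\<bar>) \<omega>\<bar> \<partial>M) + (\<integral>\<^sup>+\<omega>. ennreal \<bar>f \<omega>\<bar> \<partial>M)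
    \<le> (\<integral>\<^sup>+\<omega>. ennreal \<bar>g \<omega>\<bar> \<partial>M) + 2 * (\<integral>\<^sup>+\<omega>. ennreal \<bar>f \<omega> - real_cond_exp M (F s) g \<omega>\<bar> \<partial>M)"
proof -
  interpret S: finite_measure_subalgebra M "F s" by (rule finite_measure_subalgebra_F[OF t])
  let ?C = "real_cond_exp M (F s) (\<lambda>\<omega>. \<bar>g \<omega>\<bar>)" and ?E = "real_cond_exp M (F s) g"
  have [measurable]: "f \<in> borel_measurable M" "g \<in> borel_measurable M"
    using X(1,2) by auto
  have ig: "integrable M (\<lambda>\<omega>. \<bar>g \<omega>\<bar>)"
    using X(2) by (rule integrable_abs)
  have iE: "integrable M ?E" and iC: "integrable M ?C"
    using S.real_cond_exp_int(1) X(2) ig by auto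
  \<comment> \<open>Jensen's inequality for the absolute value, reduced to monotonicity of
    conditional expectation applied to g \<le> |g| and -g \<le> |g|.\<close>
  have lower: "AE \<omega> in M. \<bar>?E \<omega>\<bar> \<le> ?C \<omega>"
  proof -
    have "AE \<omega> in M. ?E \<omega> \<le> ?C \<omega>"
      by (rule S.real_cond_exp_mono[OF _ X(2) ig]) auto
    moreover have "AE \<omega> in M. real_cond_exp M (F s) (\<lambda>\<omega>. - g \<omega>) \<omega> \<le> ?C \<omega>"
      by (rule S.real_cond_exp_mono) (use X(2) ig in auto)
    moreover have "AE \<omega> in M. real_cond_exp M (F s) (\<lambda>\<omega>. (-1) * g \<omega>) \<omega> = (-1) * ?E \<omega>"
      by (rule S.real_cond_exp_cmult[OF X(2)])
    ultimately show ?thesis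
      by eventually_elim auto
  qed
  \<comment> \<open>The left side equals c + 2 max(|x| - c, 0), and |x| - c \<le> |x| - |e| \<le> |x
    - e|. This is the source of the factor 2.\<close>
  have pointwise: "\<bar>\<bar>x\<bar> - c\<bar> + \<bar>x\<bar> \<le> c + 2 * \<bar>x - e\<bar>" if "\<bar>e\<bar> \<le> c" for x c e :: real
  proof -
    have "\<bar>x\<bar> \<le> \<bar>e\<bar> + \<bar>x - e\<bar>"
      by linarith
    with that show ?thesis
      by (cases "\<bar>x\<bar> \<le> c") auto
  qed
  \<comment> \<open>Since \<open>ennreal\<close> sends negative reals to 0, the sum below splits,
    and the integral of \<open>?C\<close> becomes that of |g|, only once \<open>?C\<close> is known
    to be nonnegative.\<close>
  from lower have C_nonneg: "AE \<omega> in M. 0 \<le> ?C \<omega>"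
    by eventually_elim auto
  have "(\<integral>\<^sup>+\<omega>. ennreal \<bar>\<bar>f \<omega>\<bar> - ?C \<omega>\<bar> \<partial>M) + (\<integral>\<^sup>+\<omega>. ennreal \<bar>f \<omega>\<bar> \<partial>M)
      = (\<integral>\<^sup>+\<omega>. ennreal (\<bar>\<bar>f \<omega>\<bar> - ?C \<omega>\<bar> + \<bar>f \<omega>\<bar>) \<partial>M)"
    by (subst nn_integral_add[symmetric]) auto
  also have "\<dots> \<le> (\<integral>\<^sup>+\<omega>. ennreal (?C \<omega> + 2 * \<bar>f \<omega> - ?E \<omega>\<bar>) \<partial>M)"
    by (intro nn_integral_mono_AE, use lower in eventually_elim) (rule ennreal_leI, rule pointwise)
  also have "\<dots> = (\<integral>\<^sup>+\<omega>. ennreal (?C \<omega>) + 2 * ennreal \<bar>f \<omega> - ?E \<omega>\<bar> \<partial>M)"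
    by (intro nn_integral_cong_AE, use C_nonneg in eventually_elim) (simp add: ennreal_mult)
  also have "\<dots> = (\<integral>\<^sup>+\<omega>. ennreal (?C \<omega>) \<partial>M) + 2 * (\<integral>\<^sup>+\<omega>. ennreal \<bar>f \<omega> - ?E \<omega>\<bar> \<partial>M)"
    by (subst nn_integral_add) (auto simp: nn_integral_cmult)
  also have "(\<integral>\<^sup>+\<omega>. ennreal (?C \<omega>) \<partial>M) = (\<integral>\<^sup>+\<omega>. ennreal \<bar>g \<omega>\<bar> \<partial>M)"
    using S.real_cond_exp_int(2)[OF ig] C_nonneg iC ig by (simp add: nn_integral_eq_integral)
  finally show ?thesis .
qed

lemma variation_abs_le:
  assumes "adapted F X" "\<And>t. 0 \<le> t \<Longrightarrow> integrable M (X t)"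
  shows "variation M F (\<lambda>t \<omega>. \<bar>X t \<omega>\<bar>) \<le> 2 * variation M F X"
proof (unfold variation_def[of M F "\<lambda>t \<omega>. \<bar>X t \<omega>\<bar>"], rule SUP_least, clarify)
  fix n \<tau> assume p: "(n, \<tau>) \<in> time_partitions"
  note nn = time_partitions_nonneg[OF p]
  define a where "a i = (\<integral>\<^sup>+\<omega>. ennreal \<bar>\<bar>X (\<tau> i) \<omega>\<bar> - real_cond_exp M (F (\<tau> i)) (\<lambda>\<omega>. \<bar>X (\<tau> (Suc i)) \<omega>\<bar>) \<omega>\<bar> \<partial>M)" for i
  define d where "d i = (\<integral>\<^sup>+\<omega>. ennreal \<bar>X (\<tau> i) \<omega> - real_cond_exp M (F (\<tau> i)) (X (\<tau> (Suc i))) \<omega>\<bar> \<partial>M)" for i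
  define e where "e i = (\<integral>\<^sup>+\<omega>. ennreal \<bar>X (\<tau> i) \<omega>\<bar> \<partial>M)" for i
  have step: "a i + e i \<le> e (Suc i) + 2 * d i" if "i < n" for i
    unfolding a_def d_def e_def using that assms nn
    by (intro abs_cond_increment_le) (auto simp: adapted_def)
  \<comment> \<open>The intermediate terms \<open>e m\<close> are passed along by regrouping
    \<open>a m + e m\<close>, so nothing is ever cancelled in \<open>ennreal\<close>.\<close>
  have telescope: "(\<Sum>i<m. a i) + e 0 \<le> e m + 2 * (\<Sum>i<m. d i)" if "m \<le> n" for m
    using that
  proof (induction m)
    case (Suc m)
    have "(\<Sum>i<Suc m. a i) + e 0 = a m + ((\<Sum>i<m. a i) + e 0)"
      by (simp add: ac_simps)
    also have "\<dots> \<le> a m + (e m + 2 * (\<Sum>i<m. d i))"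
      using Suc by (intro add_left_mono) auto
    also have "\<dots> = (a m + e m) + 2 * (\<Sum>i<m. d i)"
      by (simp add: ac_simps)
    also have "\<dots> \<le> (e (Suc m) + 2 * d m) + 2 * (\<Sum>i<m. d i)"
      using Suc.prems by (intro add_right_mono step) auto
    finally show ?case
      by (simp add: distrib_left ac_simps)
  qed simp
  \<comment> \<open>One \<open>e n\<close> is left by the telescoping and the other is the terminal
    term of the variation; together they match the factor 2 on the sum of the \<open>d i\<close>, so
    a single constant suffices.\<close>
  have "(\<Sum>i<n. a i) + e n \<le> ((\<Sum>i<n. a i) + e 0) + e n"
    by (simp add: add_right_mono)
  also have "\<dots> \<le> (e n + 2 * (\<Sum>i<n. d i)) + e n"
    by (intro add_right_mono telescope) simp
  also have "\<dots> = 2 * ((\<Sum>i<n. d i) + e n)"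
    by (simp only: mult_2 distrib_left add_ac)
  also have "\<dots> \<le> 2 * variation M F X"
    unfolding variation_def d_def e_def by (intro mult_left_mono SUP_upper2[OF p]) auto
  finally show "(\<Sum>i<n. \<integral>\<^sup>+\<omega>. ennreal \<bar>\<bar>X (\<tau> i) \<omega>\<bar> - real_cond_exp M (F (\<tau> i)) (\<lambda>\<omega>. \<bar>X (\<tau> (Suc i)) \<omega>\<bar>) \<omega>\<bar> \<partial>M)
      + (\<integral>\<^sup>+\<omega>. ennreal \<bar>\<bar>X (\<tau> n) \<omega>\<bar>\<bar> \<partial>M) \<le> 2 * variation M F X"
    by (simp add: a_def e_def)
qed

lemma quasimartingales_abs:
  assumes "X \<in> quasimartingales M F"
  shows "(\<lambda>t \<omega>. \<bar>X t \<omega>\<bar>) \<in> quasimartingales M F"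
proof -
  from assms have X: "adapted F X" "cadlag M X" "\<And>t. 0 \<le> t \<Longrightarrow> integrable M (X t)"
      "variation M F X < \<infinity>"
    by (auto simp: quasimartingales_def)
  have "variation M F (\<lambda>t \<omega>. \<bar>X t \<omega>\<bar>) \<le> 2 * variation M F X"
    by (rule variation_abs_le[OF X(1,3)])
  also have "\<dots> < \<infinity>"
    using X(4) by (simp add: ennreal_mult_less_top)
  finally have "variation M F (\<lambda>t \<omega>. \<bar>X t \<omega>\<bar>) < \<infinity>" .
  moreover have "cadlag M (\<lambda>t \<omega>. \<bar>X t \<omega>\<bar>)"
    unfolding cadlag_def
  proof (intro ballI conjI allI impI)
    fix \<omega> and t :: real assume "\<omega> \<in> space M" "0 \<le> t"
    then show "((\<lambda>s. \<bar>X s \<omega>\<bar>) \<longlongrightarrow> \<bar>X t \<omega>\<bar>) (at_right t)"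
      using X(2) by (intro tendsto_rabs) (simp add: cadlag_def)
  next
    fix \<omega> and t :: real assume "\<omega> \<in> space M" "0 < t"
    then obtain l where "((\<lambda>s. X s \<omega>) \<longlongrightarrow> l) (at_left t)"
      using X(2) unfolding cadlag_def by blast
    then show "\<exists>l. ((\<lambda>s. \<bar>X s \<omega>\<bar>) \<longlongrightarrow> l) (at_left t)"
      by - (rule exI, rule tendsto_rabs)
  qed
  ultimately show ?thesis
    using X(1,3) by (auto simp: quasimartingales_def adapted_def)
qed

lemma quasimartingales_max:
  assumes "X \<in> quasimartingales M F" "Y \<in> quasimartingales M F"
  shows "(\<lambda>t \<omega>. max (X t \<omega>) (Y t \<omega>)) \<in> quasimartingales M F"
proof -
  \<comment> \<open>The difference is written with the scalar -1 so that closure under sums and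
    multiples applies literally.\<close>
  have "(\<lambda>t \<omega>. X t \<omega> + (-1) * Y t \<omega>) \<in> quasimartingales M F"
    by (rule quasimartingales_add[OF assms(1) quasimartingales_scale[OF assms(2)]])
  from quasimartingales_scale[OF quasimartingales_add[OF
      quasimartingales_add[OF assms] quasimartingales_abs[OF this]], of "1/2"]
  have "(\<lambda>t \<omega>. 1/2 * (X t \<omega> + Y t \<omega> + \<bar>X t \<omega> + (-1) * Y t \<omega>\<bar>)) \<in> quasimartingales M F" .
  also have "(\<lambda>t \<omega>. 1/2 * (X t \<omega> + Y t \<omega> + \<bar>X t \<omega> + (-1) * Y t \<omega>\<bar>)) = (\<lambda>t \<omega>. max (X t \<omega>) (Y t \<omega>))"
    by (intro ext) (auto simp: max_def field_simps)
  finally show ?thesis .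
qed

text \<open>Iterating the binary maximum gives a least upper bound for \<open>process_le\<close>.
  Minimality among all upper bounds is what later places \<open>Z\<close> below every member of the
  upper set.\<close>

lemma quasimartingales_finite_lub:
  assumes "finite A" "A \<noteq> {}" "A \<subseteq> quasimartingales M F"
  shows "\<exists>Z\<in>quasimartingales M F. (\<forall>X\<in>A. process_le M X Z) \<and>
    (\<forall>Y. (\<forall>X\<in>A. process_le M X Y) \<longrightarrow> process_le M Z Y)"
  using assms
proof (induction A rule: finite_ne_induct)
  case (singleton X)
  then show ?case by (auto intro: process_le_refl)
next
  case (insert X A)
  then obtain Z where Z: "Z \<in> quasimartingales M F" "\<forall>X\<in>A. process_le M X Z"
    "\<And>Y. \<forall>X\<in>A. process_le M X Y \<Longrightarrow> process_le M Z Y"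
    by auto
  let ?W = "\<lambda>t \<omega>. max (X t \<omega>) (Z t \<omega>)"
  have "?W \<in> quasimartingales M F"
    using insert.prems Z(1) by (intro quasimartingales_max) auto
  moreover have XW: "process_le M X ?W" and ZW: "process_le M Z ?W"
    by (auto simp: process_le_def)
  moreover have "\<forall>V\<in>A. process_le M V ?W"
    using Z(2) process_le_trans[OF _ ZW] by blast
  \<comment> \<open>At each fixed time the two almost sure bounds, on X and on Z, combine into one
    on their maximum.\<close>
  moreover have "process_le M ?W Y" if "\<forall>V\<in>insert X A. process_le M V Y" for Y
    using that Z(3)[of Y] by (simp add: process_le_def)
  ultimately show ?case
    by (intro bexI[of _ ?W]) simp_all
qed

end

theorem theorem3p2:
  fixes M :: "'a measure" and F :: "real \<Rightarrow> 'a measure"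
  assumes "usual_filtered_prob_space M F"
  shows "(\<forall>A B. finite A \<and> A \<noteq> {} \<and> A \<subseteq> quasimartingales M F \<and>
                finite B \<and> B \<noteq> {} \<and> B \<subseteq> quasimartingales M F \<and>
                (\<forall>X\<in>A. \<forall>Y\<in>B. process_le M X Y) \<longrightarrow>
           (\<exists>Z\<in>quasimartingales M F. \<forall>X\<in>A. \<forall>Y\<in>B. process_le M X Z \<and> process_le M Z Y))
       \<and> (\<forall>X\<in>quasimartingales M F. \<forall>Y\<in>quasimartingales M F. process_le M X Y \<longrightarrow>
           (\<exists>Z\<in>quasimartingales M F. process_le M X Z \<and> process_le M Z Y))"
proof -
  interpret usual_filtered_prob_space M F by (rule assms)
  have interpolation: "\<exists>Z\<in>quasimartingales M F. \<forall>X\<in>A. \<forall>Y\<in>B. process_le M X Z \<and> process_le M Z Y"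
    if "finite A" "A \<noteq> {}" "A \<subseteq> quasimartingales M F" "\<forall>X\<in>A. \<forall>Y\<in>B. process_le M X Y" for A B
    using quasimartingales_finite_lub[OF that(1-3)] that(4) by blast
  show ?thesis
  proof (intro conjI allI ballI impI)
    \<comment> \<open>The lower process X is itself a witness.\<close>
    fix X Y assume "X \<in> quasimartingales M F" "process_le M X Y"
    then show "\<exists>Z\<in>quasimartingales M F. process_le M X Z \<and> process_le M Z Y"
      by (blast intro: process_le_refl)
  qed (use interpolation in blast)
qed

end
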